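(* Consider the problem of minimizing $f(x)=\frac1n\sum_{i=1}^n g_i(x)+h(x)$ over $x\in\mathbb{R}^p$, under the standing assumptions in the context, and let $x^*$ be an optimal solution, $f^*=f(x^* )$. Suppose that for each $i=1,\dots,n$ the gradient $\nabla g_i$ is Lipschitz continuous with constant $L_i>0$, that $m,M$ are constants such that $L_i I\preceq mI\preceq H_k^i\preceq MI$ for all $i=1,\dots,n$ and all $k\ge 1$, and that $h$ is strongly convex with parameter $\mu_h\ge 0$. Let $L_{\max}=\max_{1\le i\le n}L_i$. Then the PROXTONE iterates $x^k$ (defined in the context), started from $x^0\in\operatorname{dom} f$, satisfy for all $k\ge 1$ $$\mathbb{E}[f(x^{k})]-f^*\le \frac{M+L_{\max}}{2}\left[\frac1n\,\frac{M+L_{\max}}{2\mu_h+m}+\Bigl(1-\frac1n\Bigr)\right]^k\|x^*-x^0\|^2 .$$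
   Context: Standing assumptions: $h$ is convex and lower semicontinuous, with closed effective domain $\operatorname{dom}(h)=\{x\in\mathbb{R}^p: h(x)<+\infty\}$. Each $g_i$ is convex and differentiable on an open set containing $\operatorname{dom}(h)$; Lipschitz continuity of $\nabla g_i$ with constant $L_i$ means $\|\nabla g_i(x)-\nabla g_i(y)\|\le L_i\|x-y\|$ for all $x,y\in\operatorname{dom}(h)$ (Euclidean norm). The minimum of $f$ is attained at some (not necessarily unique) $x^*$. Strong convexity: a convex function $\varphi$ is strongly convex with parameter $\mu\ge0$ if $\varphi(y)\ge \varphi(x)+\xi^T(y-x)+\frac{\mu}{2}\|y-x\|^2$ for all $x\in\operatorname{dom}\varphi$, $y\in\mathbb{R}^p$, $\xi\in\partial \varphi(x)$; $\mu=0$ is ordinary convexity. For symmetric matrices, $A\preceq B$ means $B-A$ is positive semidefinite. PROXTONE method. Start from $x^0\in\operatorname{dom} f$ and, for $i=1,\dots,n$, a positive definite approximation $H_0^i$ to the Hessian of $g_i$ at $x^0$, and set $$g_i^0(x)=g_i(x^0)+(x-x^0)^T\nabla g_i(x^0)+\tfrac12(x-x^0)^TH_0^i(x-x^0),\qquad G^0=\frac1n\sum_{i=1}^n g_i^0 .$$ For $k=0,1,2,\dots$: (1) $x^{k+1}=\arg\min_x\,[G^k(x)+h(x)]$; (2) sample an index $j$ uniformly at random from $\{1,\dots,n\}$; (3) take a positive definite approximation $H_{k+1}^j$ to the Hessian of $g_j$ at $x^{k+1}$ and set $$g_j^{k+1}(x)=g_j(x^{k+1})+(x-x^{k+1})^T\nabla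 g_j(x^{k+1})+\tfrac12(x-x^{k+1})^TH_{k+1}^j(x-x^{k+1});$$ for $i\ne j$ keep $g_i^{k+1}=g_i^k$ and $H_{k+1}^i=H_k^i$; set $G^{k+1}=\frac1n\sum_{i=1}^n g_i^{k+1}$. Expectations are with respect to the sampled indices.
   Formalization: The number n of components is assumed to be at least 2; for n = 1 the stated bound is false (e.g. p = 1, g_1 = 0, L_1 = 0.01, m = M = H = 1, h(x) = 50x^2, x^0 = 1, k = 1), and H_0 is not controlled by the bounds for k ≥ 1. *)

theory Defs
  imports "HOL-Probability.Probability"
begin

section \<open>Extended-valued convex functions\<close>

definition effective_domain :: "('a \<Rightarrow> ereal) \<Rightarrow> 'a set" where
  "effective_domain \<phi> = {x. \<phi> x < \<infinity>}"

text \<open>The value \<^term>\<open>-\<infinity>\<close> is excluded, so the right-hand side of the convexity inequality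
  never has the form \<^term>\<open>\<infinity> - \<infinity>\<close>; in \<^typ>\<open>ereal\<close> one has \<^prop>\<open>0 * \<infinity> = (0::ereal)\<close>.\<close>

definition ereal_convex :: "('a::real_vector \<Rightarrow> ereal) \<Rightarrow> bool" where
  "ereal_convex \<phi> \<longleftrightarrow> (\<forall>x. \<phi> x \<noteq> -\<infinity>) \<and>
     (\<forall>x y. \<forall>u\<ge>0. \<forall>v\<ge>0. u + v = 1 \<longrightarrow>
        \<phi> (u *\<^sub>R x + v *\<^sub>R y) \<le> ereal u * \<phi> x + ereal v * \<phi> y)"

definition lower_semicontinuous :: "('a::topological_space \<Rightarrow> ereal) \<Rightarrow> bool" where
  "lower_semicontinuous \<phi> \<longleftrightarrow> (\<forall>x. \<phi> x \<le> Liminf (at x) \<phi>)"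

definition subdifferential :: "('a::real_inner \<Rightarrow> ereal) \<Rightarrow> 'a \<Rightarrow> 'a set" where
  "subdifferential \<phi> x = {\<xi>. \<forall>y. \<phi> x + ereal (\<xi> \<bullet> (y - x)) \<le> \<phi> y}"

definition strongly_convex :: "real \<Rightarrow> ('a::real_inner \<Rightarrow> ereal) \<Rightarrow> bool" where
  "strongly_convex \<mu> \<phi> \<longleftrightarrow> ereal_convex \<phi> \<and> 0 \<le> \<mu> \<and>
     (\<forall>x \<in> effective_domain \<phi>. \<forall>y. \<forall>\<xi> \<in> subdifferential \<phi> x.
        \<phi> x + ereal (\<xi> \<bullet> (y - x) + \<mu> / 2 * (norm (y - x))\<^sup>2) \<le> \<phi> y)"

section \<open>Symmetric matrices\<close>

definition pos_semidef :: "real ^ 'p ^ 'p \<Rightarrow> bool" where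
  "pos_semidef A \<longleftrightarrow> transpose A = A \<and> (\<forall>v. 0 \<le> v \<bullet> (A *v v))"

definition pos_def :: "real ^ 'p ^ 'p \<Rightarrow> bool" where
  "pos_def A \<longleftrightarrow> transpose A = A \<and> (\<forall>v. v \<noteq> 0 \<longrightarrow> 0 < v \<bullet> (A *v v))"

definition loewner_le :: "real ^ 'p ^ 'p \<Rightarrow> real ^ 'p ^ 'p \<Rightarrow> bool"  (infix "\<preceq>\<^sub>L" 50) where
  "A \<preceq>\<^sub>L B \<longleftrightarrow> pos_semidef (B - A)"

section \<open>The problem\<close>

text \<open>\<open>dg\<close> is the gradient of \<open>g\<close>. Outside the open set both are arbitrary total extensions;
  \<^const>\<open>convex_on\<close> requires the open set to be convex.\<close>

definition smooth_convex_around ::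
  "'a::real_inner set \<Rightarrow> ('a \<Rightarrow> real) \<Rightarrow> ('a \<Rightarrow> 'a) \<Rightarrow> bool" where
  "smooth_convex_around D g dg \<longleftrightarrow>
     (\<exists>U. open U \<and> D \<subseteq> U \<and> convex_on U g \<and> (\<forall>x\<in>U. GDERIV g x :> dg x))"

definition objective ::
  "nat \<Rightarrow> (nat \<Rightarrow> 'a \<Rightarrow> real) \<Rightarrow> ('a \<Rightarrow> ereal) \<Rightarrow> 'a \<Rightarrow> ereal" where
  "objective n g h x = ereal (1 / real n * (\<Sum>i=1..n. g i x)) + h x"

section \<open>The PROXTONE method\<close>

definition quad_model ::
  "(real ^ 'p \<Rightarrow> real) \<Rightarrow> (real ^ 'p \<Rightarrow> real ^ 'p) \<Rightarrow> real ^ 'p ^ 'p \<Rightarrow> real ^ 'p \<Rightarrow>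
   real ^ 'p \<Rightarrow> real" where
  "quad_model g dg H z y = g z + (y - z) \<bullet> dg z + 1 / 2 * ((y - z) \<bullet> (H *v (y - z)))"

text \<open>Along one sample path: \<open>x k\<close> is the \<open>k\<close>-th iterate, \<open>j k\<close> the index sampled in iteration
  \<open>k\<close> (after \<open>x (Suc k)\<close> has been computed), and \<open>H k i\<close> the matrix held for component \<open>i\<close>
  when iteration \<open>k\<close> starts.\<close>

primrec component_model ::
  "(nat \<Rightarrow> real ^ 'p \<Rightarrow> real) \<Rightarrow> (nat \<Rightarrow> real ^ 'p \<Rightarrow> real ^ 'p) \<Rightarrow>
   (nat \<Rightarrow> nat) \<Rightarrow> (nat \<Rightarrow> real ^ 'p) \<Rightarrow> (nat \<Rightarrow> nat \<Rightarrow> real ^ 'p ^ 'p) \<Rightarrow>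
   nat \<Rightarrow> nat \<Rightarrow> real ^ 'p \<Rightarrow> real" where
  "component_model g dg j x H 0 i = quad_model (g i) (dg i) (H 0 i) (x 0)"
| "component_model g dg j x H (Suc k) i =
     (if i = j k then quad_model (g i) (dg i) (H (Suc k) i) (x (Suc k))
      else component_model g dg j x H k i)"

definition aggregate_model ::
  "nat \<Rightarrow> (nat \<Rightarrow> real ^ 'p \<Rightarrow> real) \<Rightarrow> (nat \<Rightarrow> real ^ 'p \<Rightarrow> real ^ 'p) \<Rightarrow>
   (nat \<Rightarrow> nat) \<Rightarrow> (nat \<Rightarrow> real ^ 'p) \<Rightarrow> (nat \<Rightarrow> nat \<Rightarrow> real ^ 'p ^ 'p) \<Rightarrow>
   nat \<Rightarrow> real ^ 'p \<Rightarrow> real" where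
  "aggregate_model n g dg j x H k y =
     1 / real n * (\<Sum>i=1..n. component_model g dg j x H k i y)"

definition proxtone_path ::
  "nat \<Rightarrow> (nat \<Rightarrow> real ^ 'p \<Rightarrow> real) \<Rightarrow> (nat \<Rightarrow> real ^ 'p \<Rightarrow> real ^ 'p) \<Rightarrow>
   (real ^ 'p \<Rightarrow> ereal) \<Rightarrow> real ^ 'p \<Rightarrow>
   (nat \<Rightarrow> nat) \<Rightarrow> (nat \<Rightarrow> real ^ 'p) \<Rightarrow> (nat \<Rightarrow> nat \<Rightarrow> real ^ 'p ^ 'p) \<Rightarrow> bool" where
  "proxtone_path n g dg h x0 j x H \<longleftrightarrow>
     x 0 = x0 \<and> (\<forall>i\<in>{1..n}. pos_def (H 0 i)) \<and>
     (\<forall>k. is_arg_min (\<lambda>y. ereal (aggregate_model n g dg j x H k y) + h y) (\<lambda>_. True) (x (Suc k)) \<and>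
          pos_def (H (Suc k) (j k)) \<and>
          (\<forall>i\<in>{1..n}. i \<noteq> j k \<longrightarrow> H (Suc k) i = H k i))"

definition uniform_sampling :: "'w measure \<Rightarrow> nat \<Rightarrow> (nat \<Rightarrow> 'w \<Rightarrow> nat) \<Rightarrow> bool" where
  "uniform_sampling P n j \<longleftrightarrow> prob_space P \<and>
     prob_space.indep_vars P (\<lambda>_. count_space {1..n}) j UNIV \<and>
     (\<forall>k. distr P (count_space {1..n}) (j k) = uniform_count_measure {1..n})"

text \<open>The matrices available in iteration \<open>k\<close> are determined by the indices sampled before it: they
  may depend on the whole past, but neither on future samples nor on other randomness.\<close>

definition determined_by_past ::
  "'w measure \<Rightarrow> (nat \<Rightarrow> 'w \<Rightarrow> nat) \<Rightarrow> (nat \<Rightarrow> nat \<Rightarrow> 'w \<Rightarrow> 'b) \<Rightarrow> nat \<Rightarrow> bool" where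
  "determined_by_past P j H n \<longleftrightarrow>
     (\<forall>k. \<forall>i\<in>{1..n}. \<forall>\<omega>\<in>space P. \<forall>\<omega>'\<in>space P.
        (\<forall>l<k. j l \<omega> = j l \<omega>') \<longrightarrow> H k i \<omega> = H k i \<omega>')"

end

theory Submission
  imports Defs
begin

text \<open>
  Fix a sample path and let \<open>z i\<close> be the point at which the current model of component \<open>i\<close> was built, its anchor.
  The progress of the method is measured by the average \<open>A k\<close> over \<open>i\<close> of the squared distances of the anchors
  to the solution.  In the notation below, with \<open>K\<close> for the largest Lipschitz constant, two inequalities for a
  single step (lemma \<open>proxtone_step\<close>) carry the proof:

    \<^item> \<open>(2 * \<mu> + m) * (norm (xs - x (k + 1)))\<^sup>2 \<le> (M + K) * A k\<close>, obtained by comparing the values of the model and of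
      the objective at the iterate and at the solution;
    \<^item> \<open>f (x (k + 1)) - f xs \<le> (M + K) / 4 * A k\<close>, obtained by comparing gradients.

  The index drawn in iteration \<open>k\<close> is uniform and independent of everything computed before.  Each anchor
  therefore moves to the new iterate with probability \<open>1 / n\<close> and stays otherwise, and the first inequality shows
  that the expectation of \<open>A\<close> shrinks by the factor in brackets in the theorem, called \<open>rate\<close>
  (lemma \<open>anchor_dist_contraction\<close>).

  The iterate \<open>x k\<close> comes from the model after only \<open>k - 1\<close> draws, so estimating the gap of the objective by
  function values, which gives \<open>M / 2 * A (k - 1)\<close>, in general falls short of the last factor \<open>rate\<close>.  The second
  inequality suffices: its constant is \<open>(M + K) / 4\<close>, and \<open>rate \<ge> 1 - 1 / n \<ge> 1 / 2\<close> for \<open>n \<ge> 2\<close>.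

  Two points concern the probabilistic setting.  Minimizers of the models are unique, so iterates are functions
  of finitely many sampled indices and no measurability question arises (lemma \<open>past_determines\<close>).  And the
  bounds on the matrices, stated for \<open>k \<ge> 1\<close>, extend to \<open>k = 0\<close>: the initial matrix of \<open>i\<close> is the same on all
  paths, and on a path whose first index differs from \<open>i\<close> it is still in use at time 1.
\<close>

section \<open>Convex functions and optimality conditions\<close>

lemma ereal_convex_real_value:
  assumes "ereal_convex \<phi>" and "x \<in> effective_domain \<phi>"
  shows "\<phi> x = ereal (real_of_ereal (\<phi> x))"
  using assms unfolding ereal_convex_def effective_domain_def by (cases "\<phi> x") auto

lemma ereal_convex_real_ineq:
  assumes "ereal_convex \<phi>" and "x \<in> effective_domain \<phi>" and "y \<in> effective_domain \<phi>"
    and "0 \<le> u" and "0 \<le> v" and "u + v = 1"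
  shows "u *\<^sub>R x + v *\<^sub>R y \<in> effective_domain \<phi>"
    and "real_of_ereal (\<phi> (u *\<^sub>R x + v *\<^sub>R y))
      \<le> u * real_of_ereal (\<phi> x) + v * real_of_ereal (\<phi> y)"
proof -
  let ?z = "u *\<^sub>R x + v *\<^sub>R y"
  obtain a b where ab: "\<phi> x = ereal a" "\<phi> y = ereal b"
    using ereal_convex_real_value assms(1-3) by blast
  have le: "\<phi> ?z \<le> ereal (u * a + v * b)"
    using assms ab unfolding ereal_convex_def by (metis plus_ereal.simps(1) times_ereal.simps(1))
  then show dom: "?z \<in> effective_domain \<phi>"
    unfolding effective_domain_def by (auto intro: le_less_trans)
  show "real_of_ereal (\<phi> ?z) \<le> u * real_of_ereal (\<phi> x) + v * real_of_ereal (\<phi> y)"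
    using le ereal_convex_real_value[OF assms(1) dom] ab by (metis ereal_less_eq(3) real_of_ereal.simps(1))
qed

lemma convex_effective_domain: "ereal_convex \<phi> \<Longrightarrow> convex (effective_domain \<phi>)"
  by (auto simp: convex_def intro: ereal_convex_real_ineq(1))

lemma GDERIV_along_line:
  fixes F :: "'a::real_inner \<Rightarrow> real"
  assumes "GDERIV F (x + t *\<^sub>R u) :> d"
  shows "((\<lambda>s. F (x + s *\<^sub>R u)) has_real_derivative (u \<bullet> d)) (at t)"
proof -
  have "((\<lambda>s. x + s *\<^sub>R u) has_derivative (\<lambda>s. s *\<^sub>R u)) (at t)"
    by (auto intro!: derivative_eq_intros)
  from has_derivative_compose[OF this assms[unfolded gderiv_def]]
  show ?thesis
    by (simp add: has_field_derivative_def mult_commute_abs)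
qed

text \<open>Fermat's rule for a smooth function plus a convex one.  Along the segment from the minimizer \<open>x\<close>
  to \<open>y\<close>, convexity bounds the change of \<open>h\<close> by \<open>t * (h y - h x)\<close>, so the difference quotient of \<open>F\<close> is at
  least \<open>h x - h y\<close> for every small \<open>t > 0\<close>; let \<open>t\<close> tend to 0.\<close>

lemma minimizer_neg_gradient_in_subdifferential:
  fixes F :: "'a::real_inner \<Rightarrow> real"
  assumes conv: "ereal_convex h" and x: "x \<in> effective_domain h"
    and deriv: "GDERIV F x :> d"
    and min: "\<And>y. ereal (F x) + h x \<le> ereal (F y) + h y"
  shows "- d \<in> subdifferential h x"
  unfolding subdifferential_def
proof (intro CollectI allI)
  fix y
  show "h x + ereal (- d \<bullet> (y - x)) \<le> h y"
  proof (cases "y \<in> effective_domain h")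
    case False
    then show ?thesis by (auto simp: effective_domain_def)
  next
    case y: True
    let ?r = "\<lambda>v. real_of_ereal (h v)"
    have "((\<lambda>s. F (x + s *\<^sub>R (y - x))) has_real_derivative ((y - x) \<bullet> d)) (at 0)"
      by (rule GDERIV_along_line) (use deriv in simp)
    then have "((\<lambda>t. (F (x + t *\<^sub>R (y - x)) - F x) / t) \<longlongrightarrow> (y - x) \<bullet> d) (at 0)"
      by (simp add: DERIV_def)
    then have lim: "((\<lambda>t. (F (x + t *\<^sub>R (y - x)) - F x) / t) \<longlongrightarrow> (y - x) \<bullet> d) (at_right 0)"
      by (rule filterlim_mono) (auto simp: at_le)
    have "?r x - ?r y \<le> (F (x + t *\<^sub>R (y - x)) - F x) / t" if "t \<in> {0<..<1}" for t :: real
    proof -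
      let ?z = "(1 - t) *\<^sub>R x + t *\<^sub>R y"
      have z: "x + t *\<^sub>R (y - x) = ?z" by (simp add: algebra_simps)
      note cz = ereal_convex_real_ineq[OF conv x y, of "1 - t" t]
      have zd: "?z \<in> effective_domain h" and "?r ?z \<le> (1 - t) * ?r x + t * ?r y"
        using cz that by auto
      moreover have "F x + ?r x \<le> F ?z + ?r ?z"
        using min[of ?z] ereal_convex_real_value[OF conv x] ereal_convex_real_value[OF conv zd]
        by (metis ereal_less_eq(3) plus_ereal.simps(1))
      ultimately have "t * (?r x - ?r y) \<le> F ?z - F x"
        by (simp add: algebra_simps)
      then show ?thesis
        using that by (simp add: z field_simps)
    qed
    then have "\<forall>\<^sub>F t in at_right 0. ?r x - ?r y \<le> (F (x + t *\<^sub>R (y - x)) - F x) / t"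
      by (intro eventually_at_right_less[THEN eventually_mono] eventually_at_rightI[of 0 1]) auto
    from tendsto_lowerbound[OF lim this]
    have "?r x - ?r y \<le> (y - x) \<bullet> d" by simp
    then have "?r x + (- d \<bullet> (y - x)) \<le> ?r y"
      by (simp add: inner_commute)
    then have "ereal (?r x) + ereal (- d \<bullet> (y - x)) \<le> ereal (?r y)"
      by simp
    then show ?thesis
      by (simp only: ereal_convex_real_value[OF conv x, symmetric]
          ereal_convex_real_value[OF conv y, symmetric])
  qed
qed

text \<open>Strong convexity speaks about subgradients, and the only subgradient at hand at a minimizer of
  \<open>F + h\<close> is \<open>- d\<close>.  This is the form in which the strong convexity of \<open>h\<close> enters all later estimates, both
  at the solution of the problem and at each iterate.\<close>

lemma strongly_convex_minimizer_lower_bound: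
  fixes F :: "'a::real_inner \<Rightarrow> real"
  assumes sc: "strongly_convex \<mu> h" and x: "x \<in> effective_domain h"
    and deriv: "GDERIV F x :> d"
    and min: "\<And>y. ereal (F x) + h x \<le> ereal (F y) + h y"
    and y: "y \<in> effective_domain h"
  shows "real_of_ereal (h x) - (y - x) \<bullet> d + \<mu> / 2 * (norm (y - x))\<^sup>2 \<le> real_of_ereal (h y)"
proof -
  have conv: "ereal_convex h" using sc by (simp add: strongly_convex_def)
  have "- d \<in> subdifferential h x"
    by (rule minimizer_neg_gradient_in_subdifferential[OF conv x deriv min])
  then have "h x + ereal (- d \<bullet> (y - x) + \<mu> / 2 * (norm (y - x))\<^sup>2) \<le> h y"
    using sc x unfolding strongly_convex_def by blast
  then have "real_of_ereal (h x) + (- d \<bullet> (y - x) + \<mu> / 2 * (norm (y - x))\<^sup>2) \<le> real_of_ereal (h y)"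
    using ereal_convex_real_value[OF conv x] ereal_convex_real_value[OF conv y]
    by (metis ereal_less_eq(3) plus_ereal.simps(1))
  then show ?thesis by (simp add: inner_commute)
qed

text \<open>The restriction of \<open>g\<close> to the line through \<open>z\<close> and \<open>y\<close> is a convex function of one real variable on
  an open interval around \<open>[0, 1]\<close>, so it lies above its tangent at 0.\<close>

lemma smooth_convex_tangent_below:
  fixes g :: "'a::real_inner \<Rightarrow> real"
  assumes "smooth_convex_around D g dg" and "z \<in> D" and "y \<in> D"
  shows "g z + (y - z) \<bullet> dg z \<le> g y"
proof -
  obtain U where U: "open U" "D \<subseteq> U" "convex_on U g" "\<And>x. x \<in> U \<Longrightarrow> GDERIV g x :> dg x"
    using assms(1) unfolding smooth_convex_around_def by blast
  define A where "A = (\<lambda>t::real. z + t *\<^sub>R (y - z)) -` U"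
  have line: "z + (u * s + v * t) *\<^sub>R (y - z)
      = u *\<^sub>R (z + s *\<^sub>R (y - z)) + v *\<^sub>R (z + t *\<^sub>R (y - z))" if "u + v = 1" for u v s t :: real
  proof -
    have "u *\<^sub>R z + v *\<^sub>R z = z" using that by (metis scaleR_left_distrib scaleR_one)
    then show ?thesis by (simp add: scaleR_right_distrib scaleR_left_distrib add_ac)
  qed
  have "open A"
    unfolding A_def by (intro open_vimage U(1) continuous_intros)
  have convU: "convex U" using U(3) by (simp add: convex_on_def)
  have convA: "convex A"
    unfolding convex_def
  proof (intro ballI allI impI)
    fix s t u v :: real
    assume "s \<in> A" "t \<in> A" "0 \<le> u" "0 \<le> v" "u + v = 1"
    then show "u *\<^sub>R s + v *\<^sub>R t \<in> A"
      using convU[unfolded convex_def] by (simp add: A_def line)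
  qed
  have "convex_on A (\<lambda>t. g (z + t *\<^sub>R (y - z)))"
    unfolding convex_on_def
  proof (intro conjI ballI allI impI)
    fix s t u v :: real
    assume "s \<in> A" "t \<in> A" "0 \<le> u" "0 \<le> v" "u + v = 1"
    then show "g (z + (u *\<^sub>R s + v *\<^sub>R t) *\<^sub>R (y - z))
      \<le> u * g (z + s *\<^sub>R (y - z)) + v * g (z + t *\<^sub>R (y - z))"
      using U(3) by (simp add: A_def line convex_on_def)
  qed (rule convA)
  moreover have "connected A" using convA by (rule convex_connected)
  moreover have "0 \<in> A" "1 \<in> A" using assms U(2) by (auto simp: A_def)
  moreover have "((\<lambda>t. g (z + t *\<^sub>R (y - z))) has_real_derivative (y - z) \<bullet> dg z) (at 0 within A)"
    by (rule has_field_derivative_at_within, rule GDERIV_along_line) (use U assms in auto)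
  ultimately have "g (z + 1 *\<^sub>R (y - z)) - g (z + 0 *\<^sub>R (y - z)) \<ge> ((y - z) \<bullet> dg z) * (1 - 0)"
    by (intro convex_on_imp_above_tangent) (simp_all add: interior_open[OF \<open>open A\<close>])
  then show ?thesis by simp
qed

text \<open>The descent lemma.  On the segment from \<open>z\<close> to \<open>y\<close>, which stays in the convex set \<open>D\<close>, the function
  \<open>\<psi>\<close> below (\<open>g\<close> minus its quadratic upper model) has a nonpositive derivative.\<close>

lemma lipschitz_gradient_quadratic_upper_bound:
  fixes g :: "'a::real_inner \<Rightarrow> real"
  assumes "smooth_convex_around D g dg" and D: "convex D" and z: "z \<in> D" and y: "y \<in> D"
    and lip: "L-lipschitz_on D dg"
  shows "g y \<le> g z + (y - z) \<bullet> dg z + L / 2 * (norm (y - z))\<^sup>2"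
proof -
  obtain U where U: "D \<subseteq> U" "\<And>x. x \<in> U \<Longrightarrow> GDERIV g x :> dg x"
    using assms(1) unfolding smooth_convex_around_def by blast
  let ?u = "y - z"
  let ?p = "\<lambda>t::real. z + t *\<^sub>R ?u"
  let ?\<psi> = "\<lambda>t. g (?p t) - t * (?u \<bullet> dg z) - L / 2 * (norm ?u)\<^sup>2 * t\<^sup>2"
  have "?\<psi> 1 \<le> ?\<psi> 0"
  proof (rule DERIV_nonpos_imp_nonincreasing[of 0 1])
    fix t :: real assume t: "0 \<le> t" "t \<le> 1"
    have "(1 - t) *\<^sub>R z + t *\<^sub>R y \<in> D"
      using D z y t by (simp add: convex_alt)
    then have pD: "?p t \<in> D" by (simp add: algebra_simps)
    have "(?\<psi> has_real_derivative ?u \<bullet> dg (?p t) - ?u \<bullet> dg z - L * (norm ?u)\<^sup>2 * t) (at t)"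
      using pD U by (auto intro!: derivative_eq_intros GDERIV_along_line)
    moreover have "?u \<bullet> dg (?p t) - ?u \<bullet> dg z \<le> L * (norm ?u)\<^sup>2 * t"
    proof -
      have "?u \<bullet> dg (?p t) - ?u \<bullet> dg z \<le> norm ?u * norm (dg (?p t) - dg z)"
        by (metis inner_diff_right norm_cauchy_schwarz)
      also have "\<dots> \<le> norm ?u * (L * (t * norm ?u))"
        using lipschitz_on_normD[OF lip pD z] t
        by (intro mult_left_mono) auto
      finally show ?thesis by (simp add: power2_eq_square mult_ac)
    qed
    ultimately show "\<exists>d. (?\<psi> has_real_derivative d) (at t) \<and> d \<le> 0"
      by force
  qed simp
  then show ?thesis by simp
qed

section \<open>Quadratic models and the Loewner order\<close>

lemma inner_symmetric_matrix:
  fixes A :: "real ^ 'p ^ 'p"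
  assumes "transpose A = A"
  shows "u \<bullet> (A *v w) = w \<bullet> (A *v u)"
  by (metis assms dot_lmul_matrix inner_commute transpose_matrix_vector)

lemma mat_mult_vector: "mat c *v v = c *\<^sub>R v" for v :: "real ^ 'p"
  by (simp add: vec_eq_iff matrix_vector_mult_def mat_def if_distrib if_distribR cong: if_cong)

lemma loewner_le_mat_lower:
  assumes "mat c \<preceq>\<^sub>L A"
  shows "c * (norm v)\<^sup>2 \<le> v \<bullet> (A *v v)"
proof -
  have "0 \<le> v \<bullet> ((A - mat c) *v v)"
    using assms by (simp add: loewner_le_def pos_semidef_def)
  then show ?thesis
    by (simp add: matrix_vector_mult_diff_rdistrib inner_diff_right mat_mult_vector
        power2_norm_eq_inner)
qed

lemma loewner_le_mat_upper:
  assumes "A \<preceq>\<^sub>L mat c"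
  shows "v \<bullet> (A *v v) \<le> c * (norm v)\<^sup>2"
proof -
  have "0 \<le> v \<bullet> ((mat c - A) *v v)"
    using assms by (simp add: loewner_le_def pos_semidef_def)
  then show ?thesis
    by (simp add: matrix_vector_mult_diff_rdistrib inner_diff_right mat_mult_vector
        power2_norm_eq_inner)
qed

lemma loewner_le_mat_symmetric:
  fixes A :: "real ^ 'p ^ 'p"
  assumes "mat c \<preceq>\<^sub>L A"
  shows "transpose A = A"
proof -
  have "transpose (A - mat c) = A - mat c"
    using assms by (simp add: loewner_le_def pos_semidef_def)
  then have "transpose (A - mat c) $ i $ k = (A - mat c) $ i $ k" for i k
    by simp
  then have "A $ k $ i - mat c $ k $ i = A $ i $ k - mat c $ i $ k" for i k
    by (simp add: transpose_def)
  moreover have "mat c $ k $ i = (mat c :: real ^ 'p ^ 'p) $ i $ k" for i k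
    by (simp add: mat_def)
  ultimately have "A $ k $ i = A $ i $ k" for i k
    by simp
  then show ?thesis
    by (simp add: vec_eq_iff transpose_def)
qed

lemma loewner_le_refl: "A \<preceq>\<^sub>L A"
  by (simp add: loewner_le_def pos_semidef_def transpose_def vec_eq_iff)

lemma loewner_le_mat_bounds:
  fixes A :: "real ^ 'p ^ 'p"
  assumes "mat c \<preceq>\<^sub>L A" and "A \<preceq>\<^sub>L mat d"
  shows "c \<le> d"
proof -
  obtain v :: "real ^ 'p" where "norm v = 1"
    using vector_choose_size[of 1] by auto
  then show ?thesis
    using loewner_le_mat_lower[OF assms(1), of v] loewner_le_mat_upper[OF assms(2), of v] by simp
qed

text \<open>A quadratic model can be expanded around any point, not just the one where it was built; at a
  minimizer of the aggregated model the second-order term is what gives growth.\<close>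

lemma quad_model_expansion:
  assumes "transpose H = H"
  shows "quad_model g dg H z y = quad_model g dg H z x + (y - x) \<bullet> (dg z + H *v (x - z))
    + 1 / 2 * ((y - x) \<bullet> (H *v (y - x)))"
proof -
  have split: "y - z = (x - z) + (y - x)" by simp
  show ?thesis
    unfolding quad_model_def split matrix_vector_right_distrib inner_add_left inner_add_right
    using inner_symmetric_matrix[OF assms, of "x - z" "y - x"] by (simp add: algebra_simps)
qed

lemma quad_model_GDERIV:
  fixes H :: "real ^ 'p ^ 'p"
  assumes "transpose H = H"
  shows "GDERIV (quad_model g dg H z) x :> dg z + H *v (x - z)"
proof -
  have "quad_model g dg H z = (\<lambda>y. quad_model g dg H z x + (y - x) \<bullet> (dg z + H *v (x - z))
    + 1 / 2 * ((y - x) \<bullet> (H *v (y - x))))"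
    using quad_model_expansion[OF assms] by blast
  moreover have "GDERIV (\<lambda>y. quad_model g dg H z x + (y - x) \<bullet> (dg z + H *v (x - z))
    + 1 / 2 * ((y - x) \<bullet> (H *v (y - x)))) x :> dg z + H *v (x - z)"
    unfolding gderiv_def
    by (auto intro!: derivative_eq_intros bounded_linear.has_derivative[OF matrix_vector_mul_bounded_linear])
  ultimately show ?thesis by metis
qed

lemma GDERIV_scaled_sum:
  assumes "\<And>i. i \<in> I \<Longrightarrow> GDERIV (F i) x :> d i"
  shows "GDERIV (\<lambda>y. c * (\<Sum>i\<in>I. F i y)) x :> c *\<^sub>R (\<Sum>i\<in>I. d i)"
proof -
  have "((\<lambda>y. \<Sum>i\<in>I. F i y) has_derivative (\<lambda>v. \<Sum>i\<in>I. v \<bullet> d i)) (at x)"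
    using assms by (intro has_derivative_sum) (simp add: gderiv_def)
  from has_derivative_mult_right[OF this, of c] show ?thesis
    by (simp add: gderiv_def inner_sum_right)
qed

text \<open>With \<open>a = x - z\<close>, \<open>b = xs - x\<close> and \<open>w\<close> the change of the gradient from \<open>z\<close> to \<open>x\<close>, the left factor is
  the gradient at \<open>x\<close> of the difference between the quadratic model built at \<open>z\<close> and the function it models.
  The polarization identity turns the term with \<open>H\<close> into a quarter of a difference of squares.  The gradient
  change costs \<open>K * norm a * norm b\<close>, which the parallelogram law splits between \<open>a + b\<close> and \<open>a - b\<close>; since
  \<open>K \<le> m\<close>, the negative square of \<open>a - b\<close> absorbs its share.  The constant \<open>1 / 4\<close>, where a comparison of
  function values gives only \<open>1 / 2\<close>, is essential for the final rate.\<close>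

lemma gradient_error_bound:
  fixes H :: "real ^ 'p ^ 'p"
  assumes nonneg: "0 \<le> K" and Km: "K \<le> m" and lower: "mat m \<preceq>\<^sub>L H" and upper: "H \<preceq>\<^sub>L mat M"
    and lip: "norm w \<le> K * norm a"
  shows "(H *v a - w) \<bullet> b \<le> (M + K) / 4 * (norm (a + b))\<^sup>2"
proof -
  have sym: "transpose H = H" using lower by (rule loewner_le_mat_symmetric)
  have polar: "b \<bullet> (H *v a)
    = 1 / 4 * ((a + b) \<bullet> (H *v (a + b))) - 1 / 4 * ((a - b) \<bullet> (H *v (a - b)))"
    using inner_symmetric_matrix[OF sym, of a b]
    by (simp add: matrix_vector_right_distrib matrix_vector_mult_diff_distrib
        inner_add_left inner_add_right inner_diff_left inner_diff_right algebra_simps)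
  have "- (w \<bullet> b) \<le> norm w * norm b"
    by (metis inner_minus_left norm_cauchy_schwarz norm_minus_cancel)
  also have "\<dots> \<le> K * norm a * norm b"
    using lip by (rule mult_right_mono) simp
  finally have wb: "- (w \<bullet> b) \<le> K * norm a * norm b" .
  have "norm a * norm b \<le> 1 / 4 * ((norm (a + b))\<^sup>2 + (norm (a - b))\<^sup>2)"
    using sum_squares_bound[of "norm a" "norm b"]
    by (simp add: power2_norm_eq_inner inner_add_left inner_add_right inner_diff_left inner_diff_right)
  from mult_left_mono[OF this nonneg]
  have "K * norm a * norm b \<le> K / 4 * ((norm (a + b))\<^sup>2 + (norm (a - b))\<^sup>2)"
    by simp
  moreover have "K / 4 * (norm (a - b))\<^sup>2 \<le> m / 4 * (norm (a - b))\<^sup>2"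
    using Km by (intro mult_right_mono) auto
  ultimately have "b \<bullet> (H *v a) - w \<bullet> b
      \<le> M / 4 * (norm (a + b))\<^sup>2 + K / 4 * (norm (a + b))\<^sup>2"
    using wb loewner_le_mat_lower[OF lower, of "a - b"] loewner_le_mat_upper[OF upper, of "a + b"]
    unfolding polar by (simp add: algebra_simps)
  then show ?thesis
    by (simp add: inner_diff_left inner_commute[of "H *v a"] algebra_simps)
qed


section \<open>One step of the method\<close>

text \<open>One Lipschitz constant \<open>K\<close> serves all components; for the theorem it is the largest of the \<open>L i\<close>.\<close>

locale composite_problem =
  fixes n :: nat and g :: "nat \<Rightarrow> real ^ 'p \<Rightarrow> real" and dg :: "nat \<Rightarrow> real ^ 'p \<Rightarrow> real ^ 'p"
    and h :: "real ^ 'p \<Rightarrow> ereal" and K \<mu> :: real and xs :: "real ^ 'p"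
  assumes n_pos: "0 < n"
    and K_nonneg: "0 \<le> K"
    and h_strong: "strongly_convex \<mu> h"
    and smooth: "\<And>i. i \<in> {1..n} \<Longrightarrow> smooth_convex_around (effective_domain h) (g i) (dg i)"
    and lipschitz: "\<And>i. i \<in> {1..n} \<Longrightarrow> K-lipschitz_on (effective_domain h) (dg i)"
    and minimizer: "is_arg_min (objective n g h) (\<lambda>_. True) xs"
    and proper: "effective_domain h \<noteq> {}"
begin

abbreviation dom_h :: "(real ^ 'p) set" where
  "dom_h \<equiv> effective_domain h"

abbreviation hr :: "real ^ 'p \<Rightarrow> real" where
  "hr y \<equiv> real_of_ereal (h y)"

abbreviation average :: "(nat \<Rightarrow> real) \<Rightarrow> real" where
  "average a \<equiv> 1 / real n * (\<Sum>i=1..n. a i)"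

abbreviation fr :: "real ^ 'p \<Rightarrow> real" where
  "fr y \<equiv> real_of_ereal (objective n g h y)"

lemma h_convex: "ereal_convex h"
  using h_strong by (simp add: strongly_convex_def)

lemma mu_nonneg: "0 \<le> \<mu>"
  using h_strong by (simp add: strongly_convex_def)

lemma average_mono:
  assumes "\<And>i. i \<in> {1..n} \<Longrightarrow> a i \<le> b i"
  shows "average a \<le> average b"
  by (rule mult_left_mono, rule sum_mono, rule assms) simp_all

lemma average_const: "average (\<lambda>_. c) = c"
  using n_pos by simp

lemma average_add: "average (\<lambda>i. a i + b i) = average a + average b"
  by (simp only: sum.distrib distrib_left)

lemma average_diff: "average (\<lambda>i. a i - b i) = average a - average b"
  by (simp only: sum_subtractf right_diff_distrib)

lemma average_scale: "average (\<lambda>i. c * a i) = c * average a"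
  by (subst sum_distrib_left[symmetric]) (rule mult.left_commute)

lemma inner_average: "v \<bullet> ((1 / real n) *\<^sub>R (\<Sum>i=1..n. w i)) = average (\<lambda>i. v \<bullet> w i)"
  by (simp only: inner_scaleR_right inner_sum_right)

lemma objective_real:
  assumes "y \<in> dom_h"
  shows "fr y = average (\<lambda>i. g i y) + hr y"
proof -
  obtain r where "h y = ereal r" using ereal_convex_real_value[OF h_convex assms] by blast
  then show ?thesis by (simp add: objective_def)
qed

lemma arg_min_in_domain:
  assumes "is_arg_min (\<lambda>y. ereal (F y) + h y) (\<lambda>_. True) x"
  shows "x \<in> dom_h" and "\<And>y. ereal (F x) + h x \<le> ereal (F y) + h y"
proof -
  show le: "ereal (F x) + h x \<le> ereal (F y) + h y" for y
    using assms unfolding is_arg_min_def by (metis not_less)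
  obtain y where "h y < \<infinity>" using proper by (auto simp: effective_domain_def)
  then have "ereal (F x) + h x < \<infinity>"
    using le[of y] by (auto intro: le_less_trans)
  then show "x \<in> dom_h" by (auto simp: effective_domain_def)
qed

lemma minimizer_in_domain: "xs \<in> dom_h"
  using minimizer arg_min_in_domain[of "\<lambda>y. average (\<lambda>i. g i y)" xs]
  by (simp add: objective_def[abs_def])

text \<open>The average of the \<open>g i\<close> lies above its tangent at the solution \<open>xs\<close>, and the slope of that tangent
  is compensated by the subgradient of \<open>h\<close>; the growth left over is that of \<open>h\<close>.\<close>

lemma objective_growth:
  assumes y: "y \<in> dom_h"
  shows "fr xs + \<mu> / 2 * (norm (y - xs))\<^sup>2 \<le> fr y"
proof -
  let ?G = "\<lambda>y. average (\<lambda>i. g i y)"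
  let ?d = "(1 / real n) *\<^sub>R (\<Sum>i=1..n. dg i xs)"
  note xs = minimizer_in_domain
  have deriv: "GDERIV ?G xs :> ?d"
    using smooth xs by (intro GDERIV_scaled_sum) (force simp: smooth_convex_around_def)
  have min: "ereal (?G xs) + h xs \<le> ereal (?G y) + h y" for y
    using minimizer arg_min_in_domain(2)[of ?G xs] by (simp add: objective_def[abs_def])
  have "hr xs - (y - xs) \<bullet> ?d + \<mu> / 2 * (norm (y - xs))\<^sup>2 \<le> hr y"
    by (rule strongly_convex_minimizer_lower_bound[OF h_strong xs deriv min y])
  moreover have "average (\<lambda>i. g i xs + (y - xs) \<bullet> dg i xs) \<le> ?G y"
    by (intro average_mono smooth_convex_tangent_below[OF smooth xs y]) auto
  ultimately show ?thesis
    unfolding objective_real[OF xs] objective_real[OF y] average_add inner_average by linarith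
qed

text \<open>At its minimizer the regularized model has zero total slope, so it grows by the strong convexity of \<open>h\<close>
  together with the curvature \<open>m\<close> of the quadratic models.\<close>

lemma model_growth:
  fixes H :: "nat \<Rightarrow> real ^ 'p ^ 'p"
  assumes H: "\<And>i. i \<in> {1..n} \<Longrightarrow> mat m \<preceq>\<^sub>L H i"
    and x: "is_arg_min (\<lambda>y. ereal (average (\<lambda>i. quad_model (g i) (dg i) (H i) (z i) y)) + h y)
              (\<lambda>_. True) x"
    and y: "y \<in> dom_h"
  shows "average (\<lambda>i. quad_model (g i) (dg i) (H i) (z i) x) + hr x
      + (\<mu> + m) / 2 * (norm (y - x))\<^sup>2
    \<le> average (\<lambda>i. quad_model (g i) (dg i) (H i) (z i) y) + hr y"
proof -
  let ?q = "\<lambda>i. quad_model (g i) (dg i) (H i) (z i)"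
  let ?d = "\<lambda>i. dg i (z i) + H i *v (x - z i)"
  note min = arg_min_in_domain[OF x]
  have sym: "transpose (H i) = H i" if "i \<in> {1..n}" for i
    using H[OF that] by (rule loewner_le_mat_symmetric)
  have "hr x - (y - x) \<bullet> ((1 / real n) *\<^sub>R (\<Sum>i=1..n. ?d i)) + \<mu> / 2 * (norm (y - x))\<^sup>2 \<le> hr y"
    by (rule strongly_convex_minimizer_lower_bound[OF h_strong min(1) _ min(2) y],
        intro GDERIV_scaled_sum quad_model_GDERIV sym)
  moreover have "average (\<lambda>i. ?q i x + (y - x) \<bullet> ?d i + 1 / 2 * (m * (norm (y - x))\<^sup>2))
      \<le> average (\<lambda>i. ?q i y)"
  proof (intro average_mono)
    fix i assume i: "i \<in> {1..n}"
    show "?q i x + (y - x) \<bullet> ?d i + 1 / 2 * (m * (norm (y - x))\<^sup>2) \<le> ?q i y"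
      using quad_model_expansion[OF sym[OF i], of "g i" "dg i" "z i" y x]
        loewner_le_mat_lower[OF H[OF i], of "y - x"] by simp
  qed
  ultimately show ?thesis
    unfolding average_add inner_average average_const by (simp add: algebra_simps add_divide_distrib)
qed

text \<open>Uniqueness makes the iterates functions of the sampled indices: the method leaves no freedom in
  the choice of the minimizer.\<close>

lemma model_minimizer_unique:
  fixes H :: "nat \<Rightarrow> real ^ 'p ^ 'p"
  assumes "0 < m" and H: "\<And>i. i \<in> {1..n} \<Longrightarrow> mat m \<preceq>\<^sub>L H i"
    and x: "is_arg_min (\<lambda>y. ereal (average (\<lambda>i. quad_model (g i) (dg i) (H i) (z i) y)) + h y)
              (\<lambda>_. True) x"
    and y: "is_arg_min (\<lambda>y. ereal (average (\<lambda>i. quad_model (g i) (dg i) (H i) (z i) y)) + h y)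
              (\<lambda>_. True) y"
  shows "x = y"
proof -
  have "(\<mu> + m) * (norm (y - x))\<^sup>2 \<le> 0"
    using model_growth[OF H x arg_min_in_domain(1)[OF y]]
      model_growth[OF H y arg_min_in_domain(1)[OF x]]
    by (simp add: norm_minus_commute[of x y])
  then show ?thesis
    using assms(1) mu_nonneg by (simp add: mult_le_0_iff)
qed

text \<open>One step of the method, whatever the expansion points \<open>z i\<close>.

  For the distance: the models majorize the \<open>g i\<close> by the descent lemma, and at \<open>xs\<close> they exceed them by at most
  \<open>M / 2\<close> times the squared distance to the expansion point.  Comparing the model at its minimizer \<open>x\<close> with its
  value at \<open>xs\<close> yields the growth \<open>(\<mu> + m) / 2\<close>, and the growth of the objective itself contributes a second
  \<open>\<mu> / 2\<close>.

  For the value: the gradient of the model at \<open>x\<close> is, up to sign, a subgradient of \<open>h\<close>, so by convexity the gap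
  of the objective is at most the inner product of the gradient error with \<open>xs - x\<close>.  The factor \<open>1 / 4\<close>
  in place of \<open>1 / 2\<close> pays for the index shift in \<open>expected_objective_gap\<close>.\<close>

lemma proxtone_step:
  fixes H :: "nat \<Rightarrow> real ^ 'p ^ 'p"
  assumes Km: "K \<le> m"
    and lower: "\<And>i. i \<in> {1..n} \<Longrightarrow> mat m \<preceq>\<^sub>L H i"
    and upper: "\<And>i. i \<in> {1..n} \<Longrightarrow> H i \<preceq>\<^sub>L mat M"
    and z: "\<And>i. i \<in> {1..n} \<Longrightarrow> z i \<in> dom_h"
    and x: "is_arg_min (\<lambda>y. ereal (average (\<lambda>i. quad_model (g i) (dg i) (H i) (z i) y)) + h y)
              (\<lambda>_. True) x"
  shows "(2 * \<mu> + m) * (norm (xs - x))\<^sup>2 \<le> (M + K) * average (\<lambda>i. (norm (xs - z i))\<^sup>2)"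
    and "fr x - fr xs \<le> (M + K) / 4 * average (\<lambda>i. (norm (xs - z i))\<^sup>2)"
proof -
  let ?q = "\<lambda>i. quad_model (g i) (dg i) (H i) (z i)"
  let ?d = "\<lambda>i. dg i (z i) + H i *v (x - z i)"
  let ?A = "average (\<lambda>i. (norm (xs - z i))\<^sup>2)"
  note min = arg_min_in_domain[OF x] and xs = minimizer_in_domain
  have dconv: "convex dom_h" using h_convex by (rule convex_effective_domain)

  \<comment> \<open>the model lies above the function it models\<close>
  have majorize: "average (\<lambda>i. g i x) \<le> average (\<lambda>i. ?q i x)"
  proof (intro average_mono)
    fix i assume i: "i \<in> {1..n}"
    have "K / 2 * (norm (x - z i))\<^sup>2 \<le> m / 2 * (norm (x - z i))\<^sup>2"
      using Km by (intro mult_right_mono) auto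
    then show "g i x \<le> ?q i x"
      using lipschitz_gradient_quadratic_upper_bound
          [OF smooth[OF i] dconv z[OF i] min(1) lipschitz[OF i]]
        loewner_le_mat_lower[OF lower[OF i], of "x - z i"]
      by (simp add: quad_model_def)
  qed
  \<comment> \<open>and, by convexity of the functions, not too far above it at the solution\<close>
  have gap: "average (\<lambda>i. ?q i xs) \<le> average (\<lambda>i. g i xs + M / 2 * (norm (xs - z i))\<^sup>2)"
  proof (intro average_mono)
    fix i assume i: "i \<in> {1..n}"
    show "?q i xs \<le> g i xs + M / 2 * (norm (xs - z i))\<^sup>2"
      using smooth_convex_tangent_below[OF smooth[OF i] z[OF i] xs]
        loewner_le_mat_upper[OF upper[OF i], of "xs - z i"]
      by (simp add: quad_model_def)
  qed
  have "fr x + (\<mu> + m) / 2 * (norm (xs - x))\<^sup>2 \<le> fr xs + M / 2 * ?A"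
    using majorize gap model_growth[OF lower x xs]
    unfolding objective_real[OF xs] objective_real[OF min(1)] average_add average_scale by linarith
  then have "(2 * \<mu> + m) * (norm (xs - x))\<^sup>2 \<le> M * ?A"
    using objective_growth[OF min(1)] by (simp add: norm_minus_commute[of x xs] field_simps)
  moreover have "0 \<le> K * ?A"
    using K_nonneg by (intro mult_nonneg_nonneg sum_nonneg) auto
  ultimately show "(2 * \<mu> + m) * (norm (xs - x))\<^sup>2 \<le> (M + K) * ?A"
    unfolding distrib_right by linarith

  have "hr x - (xs - x) \<bullet> ((1 / real n) *\<^sub>R (\<Sum>i=1..n. ?d i)) + \<mu> / 2 * (norm (xs - x))\<^sup>2 \<le> hr xs"
    by (rule strongly_convex_minimizer_lower_bound[OF h_strong min(1) _ min(2) xs],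
        intro GDERIV_scaled_sum quad_model_GDERIV loewner_le_mat_symmetric[OF lower])
  moreover have "0 \<le> \<mu> / 2 * (norm (xs - x))\<^sup>2" using mu_nonneg by simp
  moreover have "average (\<lambda>i. (xs - x) \<bullet> ?d i)
      \<le> average (\<lambda>i. g i xs - g i x + (M + K) / 4 * (norm (xs - z i))\<^sup>2)"
  proof (intro average_mono)
    fix i assume i: "i \<in> {1..n}"
    have "norm (dg i x - dg i (z i)) \<le> K * norm (x - z i)"
      using lipschitz_on_normD[OF lipschitz[OF i] min(1) z[OF i]] .
    then have "(H i *v (x - z i) - (dg i x - dg i (z i))) \<bullet> (xs - x)
        \<le> (M + K) / 4 * (norm ((x - z i) + (xs - x)))\<^sup>2"
      by (intro gradient_error_bound[OF K_nonneg Km lower upper] i)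
    then have "(H i *v (x - z i) - (dg i x - dg i (z i))) \<bullet> (xs - x)
        \<le> (M + K) / 4 * (norm (xs - z i))\<^sup>2"
      by simp
    moreover have "(xs - x) \<bullet> ?d i
        = (H i *v (x - z i) - (dg i x - dg i (z i))) \<bullet> (xs - x) + (xs - x) \<bullet> dg i x"
      by (simp add: inner_add_left inner_add_right inner_diff_left inner_diff_right inner_commute)
    ultimately show "(xs - x) \<bullet> ?d i \<le> g i xs - g i x + (M + K) / 4 * (norm (xs - z i))\<^sup>2"
      using smooth_convex_tangent_below[OF smooth[OF i] min(1) xs] by linarith
  qed
  ultimately show "fr x - fr xs \<le> (M + K) / 4 * ?A"
    unfolding objective_real[OF xs] objective_real[OF min(1)] inner_average average_add
      average_diff average_scale
    by linarith
qed

end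

section \<open>Sample paths\<close>

text \<open>The point at which the current model of component \<open>i\<close> was built.\<close>

primrec anchor :: "(nat \<Rightarrow> nat) \<Rightarrow> (nat \<Rightarrow> 'a) \<Rightarrow> nat \<Rightarrow> nat \<Rightarrow> 'a" where
  "anchor j x 0 i = x 0"
| "anchor j x (Suc k) i = (if i = j k then x (Suc k) else anchor j x k i)"

text \<open>The matrix in use for a component at time \<open>k\<close> is the one of the last refresh, because matrices
  change only together with the models.  This gives every model the same closed form.\<close>

lemma component_model_eq_quad_model:
  assumes "proxtone_path n g dg h x0 j x H" and "i \<in> {1..n}"
  shows "component_model g dg j x H k i = quad_model (g i) (dg i) (H k i) (anchor j x k i)"
  using assms by (induction k) (auto simp: proxtone_path_def)

context composite_problem
begin

lemma path_minimizes_model: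
  assumes "proxtone_path n g dg h x0 j x H"
  shows "is_arg_min
    (\<lambda>y. ereal (average (\<lambda>i. quad_model (g i) (dg i) (H k i) (anchor j x k i) y)) + h y)
    (\<lambda>_. True) (x (Suc k))"
proof -
  have "aggregate_model n g dg j x H k
      = (\<lambda>y. average (\<lambda>i. quad_model (g i) (dg i) (H k i) (anchor j x k i) y))"
    unfolding aggregate_model_def[abs_def]
    by (simp only: component_model_eq_quad_model[OF assms] cong: sum.cong)
  moreover have "is_arg_min (\<lambda>y. ereal (aggregate_model n g dg j x H k y) + h y)
      (\<lambda>_. True) (x (Suc k))"
    using assms by (simp add: proxtone_path_def)
  ultimately show ?thesis by simp
qed

lemma path_in_domain:
  assumes "proxtone_path n g dg h x0 j x H" and "x0 \<in> dom_h"
  shows "x k \<in> dom_h"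
  using assms(2) arg_min_in_domain(1)[OF path_minimizes_model[OF assms(1)]] assms(1)
  by (cases k) (auto simp: proxtone_path_def)

lemma anchor_in_domain:
  assumes "proxtone_path n g dg h x0 j x H" and "x0 \<in> dom_h"
  shows "anchor j x k i \<in> dom_h"
  by (induction k) (use path_in_domain[OF assms] in auto)

text \<open>Two runs that have drawn the same first \<open>k\<close> indices agree on everything computed before the next
  draw, including the next iterate: they minimize the same model, which has only one minimizer.\<close>

lemma path_determined_by_past:
  fixes H H' :: "nat \<Rightarrow> nat \<Rightarrow> real ^ 'p ^ 'p"
  assumes path: "proxtone_path n g dg h x0 j x H"
    and path': "proxtone_path n g dg h x0 j' x' H'"
    and "0 < m" and H: "\<And>k i. i \<in> {1..n} \<Longrightarrow> mat m \<preceq>\<^sub>L H k i"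
    and eqH: "\<And>k i. i \<in> {1..n} \<Longrightarrow> \<forall>l<k. j l = j' l \<Longrightarrow> H k i = H' k i"
    and "\<forall>l<k. j l = j' l"
  shows "anchor j x k = anchor j' x' k" and "x (Suc k) = x' (Suc k)"
proof -
  have step: "x (Suc k) = x' (Suc k)"
    if "\<forall>l<k. j l = j' l" and "anchor j x k = anchor j' x' k" for k
  proof (rule model_minimizer_unique[OF \<open>0 < m\<close> H path_minimizes_model[OF path]])
    have eq: "H k i = H' k i" if "i \<in> {1..n}" for i
      using eqH that \<open>\<forall>l<k. j l = j' l\<close> by blast
    show "is_arg_min
      (\<lambda>y. ereal (average (\<lambda>i. quad_model (g i) (dg i) (H k i) (anchor j x k i) y)) + h y)
      (\<lambda>_. True) (x' (Suc k))"
      using path_minimizes_model[OF path', of k] by (simp only: eq that(2) cong: sum.cong)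
  qed
  have "anchor j x k = anchor j' x' k"
    using assms(6)
  proof (induction k)
    case 0
    then show ?case using path path' by (auto simp: proxtone_path_def)
  next
    case (Suc k)
    then have "anchor j x k = anchor j' x' k" and "x (Suc k) = x' (Suc k)" and "j k = j' k"
      using step by auto
    then show ?case by auto
  qed
  then show "anchor j x k = anchor j' x' k" and "x (Suc k) = x' (Suc k)"
    using step assms(6) by blast+
qed

end

section \<open>Uniform sampling\<close>

lemma uniform_sampling_index_probability:
  assumes "uniform_sampling P n j" and "i \<in> {1..n}"
  shows "integrable P (\<lambda>\<omega>. of_bool (j k \<omega> = i) :: real)"
    and "prob_space.expectation P (\<lambda>\<omega>. of_bool (j k \<omega> = i)) = 1 / real n"
proof -
  interpret prob_space P using assms(1) by (simp add: uniform_sampling_def)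
  have jm: "j k \<in> measurable P (count_space {1..n})"
    using assms(1) by (auto simp: uniform_sampling_def indep_vars_def)
  then show "integrable P (\<lambda>\<omega>. of_bool (j k \<omega> = i) :: real)"
    by (intro integrable_const_bound[where B = 1] measurable_compose[OF jm]) auto
  have "expectation (\<lambda>\<omega>. of_bool (j k \<omega> = i))
      = integral\<^sup>L (distr P (count_space {1..n}) (j k)) (\<lambda>l. of_bool (l = i) :: real)"
    by (subst integral_distr[OF jm]) simp_all
  also have "\<dots> = (\<Sum>l\<in>{1..n}. of_bool (l = i)) / card {1..n}"
    using assms(1) by (simp add: uniform_sampling_def integral_uniform_count_measure)
  also have "\<dots> = 1 / real n"
    using assms(2) by (simp add: of_bool_def)
  finally show "expectation (\<lambda>\<omega>. of_bool (j k \<omega> = i)) = 1 / real n" .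
qed

text \<open>Paths with a prescribed index exist because that event has positive probability.\<close>

lemma uniform_sampling_index_attained:
  assumes "uniform_sampling P n j" and "i \<in> {1..n}"
  obtains \<omega> where "\<omega> \<in> space P" and "j k \<omega> = i"
proof -
  have "\<exists>\<omega>\<in>space P. j k \<omega> = i"
  proof (rule ccontr)
    assume "\<not> ?thesis"
    then have "(LINT \<omega>|P. of_bool (j k \<omega> = i)) = (LINT \<omega>|P. (0::real))"
      by (intro Bochner_Integration.integral_cong) auto
    then show False
      using uniform_sampling_index_probability(2)[OF assms, of k] assms(2) by simp
  qed
  then show ?thesis using that by blast
qed

text \<open>A quantity determined by the first \<open>k\<close> indices takes finitely many values, hence is measurable and
  integrable whatever the space underneath.  It factors through the tuple \<open>T\<close> of these indices, which is
  independent of the next one, so the expectation of the product splits.\<close>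

lemma uniform_sampling_next_index:
  fixes X :: "'w \<Rightarrow> real"
  assumes sampling: "uniform_sampling P n j"
    and past: "\<And>\<omega> \<omega>'. \<omega> \<in> space P \<Longrightarrow> \<omega>' \<in> space P \<Longrightarrow> \<forall>l<k. j l \<omega> = j l \<omega>' \<Longrightarrow> X \<omega> = X \<omega>'"
  shows integrable_past: "integrable P X"
    and "i \<in> {1..n} \<Longrightarrow> integrable P (\<lambda>\<omega>. of_bool (j k \<omega> = i) * X \<omega>)"
    and "i \<in> {1..n} \<Longrightarrow> prob_space.expectation P (\<lambda>\<omega>. of_bool (j k \<omega> = i) * X \<omega>)
      = 1 / real n * prob_space.expectation P X"
proof -
  interpret prob_space P using sampling by (simp add: uniform_sampling_def)
  let ?N = "\<lambda>_::nat. count_space {1..n}"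
  define T where "T \<omega> = restrict (\<lambda>l. j l \<omega>) {..<k}" for \<omega>
  \<comment> \<open>any path with the given index tuple may represent it\<close>
  define F where "F a = X (SOME \<omega>. \<omega> \<in> space P \<and> T \<omega> = a)" for a
  let ?S = "{..<k} \<rightarrow>\<^sub>E {1..n}"
  have ind: "indep_vars ?N j UNIV" using sampling by (simp add: uniform_sampling_def)
  then have jm: "j l \<in> measurable P (count_space {1..n})" for l
    by (auto simp: indep_vars_def)
  have N: "PiM {..<k} ?N = count_space ?S"
    by (rule count_space_PiM_finite) auto
  have Tm: "T \<in> measurable P (count_space ?S)"
    unfolding N[symmetric] T_def by (intro measurable_restrict jm)
  have XF: "X \<omega> = F (T \<omega>)" if "\<omega> \<in> space P" for \<omega>
  proof -
    have ex: "(SOME \<omega>'. \<omega>' \<in> space P \<and> T \<omega>' = T \<omega>) \<in> space P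
        \<and> T (SOME \<omega>'. \<omega>' \<in> space P \<and> T \<omega>' = T \<omega>) = T \<omega>"
      by (rule someI[of _ \<omega>]) (use that in simp)
    have "\<forall>l<k. j l \<omega>1 = j l \<omega>2" if "T \<omega>1 = T \<omega>2" for \<omega>1 \<omega>2
      using that unfolding T_def by (metis lessThan_iff restrict_apply')
    then show ?thesis
      unfolding F_def using past ex that by metis
  qed
  have FTm: "(\<lambda>\<omega>. F (T \<omega>)) \<in> borel_measurable P"
    by (rule measurable_compose[OF Tm]) simp
  then have Xm: "X \<in> borel_measurable P"
    using XF by (simp cong: measurable_cong)
  have finS: "finite ?S" by (intro finite_PiE) auto
  have "\<bar>X \<omega>\<bar> \<le> (\<Sum>a\<in>?S. \<bar>F a\<bar>)" if "\<omega> \<in> space P" for \<omega>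
    unfolding XF[OF that]
    by (rule member_le_sum) (use finS measurable_space[OF Tm that] in auto)
  then show Xi: "integrable P X"
    by (intro integrable_const_bound[where B = "\<Sum>a\<in>?S. \<bar>F a\<bar>"] Xm) auto
  assume i: "i \<in> {1..n}"
  let ?Y = "\<lambda>\<omega>. of_bool (j k \<omega> = i) :: real"
  note Y = uniform_sampling_index_probability[OF sampling i, of k]
  have FTi: "integrable P (\<lambda>\<omega>. F (T \<omega>))"
    using Xi XF by (simp cong: Bochner_Integration.integrable_cong)
  have "indep_var (PiM {..<k} ?N) T (PiM {k} ?N) (\<lambda>\<omega>. restrict (\<lambda>l. j l \<omega>) {k})"
    unfolding T_def by (rule indep_var_restrict[OF ind]) auto
  moreover have "F \<in> borel_measurable (PiM {..<k} ?N)"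
    unfolding N by simp
  moreover have "(\<lambda>b. of_bool (b k = i) :: real) \<in> borel_measurable (PiM {k} ?N)"
    by (rule measurable_compose[OF measurable_component_singleton]) auto
  ultimately have "indep_var borel (F \<circ> T) borel
      ((\<lambda>b. of_bool (b k = i)) \<circ> (\<lambda>\<omega>. restrict (\<lambda>l. j l \<omega>) {k}))"
    by (rule indep_var_compose)
  then have ind': "indep_var borel (\<lambda>\<omega>. F (T \<omega>)) borel ?Y"
    by (simp add: o_def)
  note Z = indep_var_lebesgue_integral[OF ind' FTi Y(1)] indep_var_integrable[OF ind' FTi Y(1)]
  have eq: "?Y \<omega> * X \<omega> = F (T \<omega>) * ?Y \<omega>" if "\<omega> \<in> space P" for \<omega>
    using XF[OF that] by simp
  show "integrable P (\<lambda>\<omega>. ?Y \<omega> * X \<omega>)"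
    by (subst Bochner_Integration.integrable_cong[OF refl eq]) (use Z(2) in auto)
  have "expectation (\<lambda>\<omega>. ?Y \<omega> * X \<omega>) = expectation (\<lambda>\<omega>. F (T \<omega>) * ?Y \<omega>)"
    using eq by (rule Bochner_Integration.integral_cong[OF refl])
  also have "\<dots> = expectation (\<lambda>\<omega>. F (T \<omega>)) * (1 / real n)"
    unfolding Z(1) Y(2) ..
  also have "expectation (\<lambda>\<omega>. F (T \<omega>)) = expectation X"
    using XF by (intro Bochner_Integration.integral_cong) auto
  finally show "expectation (\<lambda>\<omega>. ?Y \<omega> * X \<omega>) = 1 / real n * expectation X"
    by simp
qed


section \<open>Contraction in expectation\<close>

text \<open>In contrast to the theorem below, the matrix bounds include \<open>k = 0\<close>; they are derived from those for
  \<open>k = 1\<close> when the locale is interpreted.\<close>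

locale proxtone = composite_problem n g dg h K \<mu> xs
  for n :: nat and g :: "nat \<Rightarrow> real ^ 'p \<Rightarrow> real" and dg :: "nat \<Rightarrow> real ^ 'p \<Rightarrow> real ^ 'p"
    and h :: "real ^ 'p \<Rightarrow> ereal" and K \<mu> :: real and xs :: "real ^ 'p" +
  fixes m M :: real and x0 :: "real ^ 'p"
    and P :: "'w measure" and j :: "nat \<Rightarrow> 'w \<Rightarrow> nat"
    and x :: "nat \<Rightarrow> 'w \<Rightarrow> real ^ 'p" and H :: "nat \<Rightarrow> nat \<Rightarrow> 'w \<Rightarrow> real ^ 'p ^ 'p"
  assumes n_ge_2: "2 \<le> n"
    and m_pos: "0 < m" and K_le_m: "K \<le> m"
    and start: "x0 \<in> effective_domain h"
    and sampling: "uniform_sampling P n j"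
    and H_past: "determined_by_past P j H n"
    and path: "\<And>\<omega>. \<omega> \<in> space P \<Longrightarrow>
      proxtone_path n g dg h x0 (\<lambda>k. j k \<omega>) (\<lambda>k. x k \<omega>) (\<lambda>k i. H k i \<omega>)"
    and H_lower: "\<And>k i \<omega>. i \<in> {1..n} \<Longrightarrow> \<omega> \<in> space P \<Longrightarrow> mat m \<preceq>\<^sub>L H k i \<omega>"
    and H_upper: "\<And>k i \<omega>. i \<in> {1..n} \<Longrightarrow> \<omega> \<in> space P \<Longrightarrow> H k i \<omega> \<preceq>\<^sub>L mat M"
begin

sublocale prob_space P
  using sampling by (simp add: uniform_sampling_def)

definition anchor_dist :: "nat \<Rightarrow> nat \<Rightarrow> 'w \<Rightarrow> real" where
  "anchor_dist k i \<omega> = (norm (xs - anchor (\<lambda>k. j k \<omega>) (\<lambda>k. x k \<omega>) k i))\<^sup>2"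

text \<open>The expected decrease factor: with probability \<open>1 / n\<close> a given anchor moves to the new iterate, whose
  squared distance to the solution is controlled by the average over the old anchors; otherwise it stays.\<close>

definition rate :: real where
  "rate = 1 / real n * ((M + K) / (2 * \<mu> + m)) + (1 - 1 / real n)"

lemma m_le_M: "m \<le> M"
proof -
  obtain \<omega> where "\<omega> \<in> space P" using not_empty by blast
  then show ?thesis
    using loewner_le_mat_bounds[OF H_lower H_upper, of 1] n_pos by auto
qed

text \<open>Any single anchor is kept with probability at least \<open>1 / 2\<close>, so a step cannot gain more than a factor
  of two.\<close>

lemma rate_ge_half: "1 / 2 \<le> rate"
proof -
  have "1 / real n \<le> 1 / 2" using n_ge_2 by (simp add: field_simps)
  moreover have "0 \<le> 1 / real n * ((M + K) / (2 * \<mu> + m))"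
    using m_pos m_le_M K_nonneg mu_nonneg by simp
  ultimately show ?thesis unfolding rate_def by linarith
qed

lemma iterate_in_domain: "\<omega> \<in> space P \<Longrightarrow> x k \<omega> \<in> dom_h"
  using path_in_domain[OF path start] .

lemma step_bounds:
  assumes "\<omega> \<in> space P"
  shows "(2 * \<mu> + m) * (norm (xs - x (Suc k) \<omega>))\<^sup>2 \<le> (M + K) * average (\<lambda>i. anchor_dist k i \<omega>)"
    and "fr (x (Suc k) \<omega>) - fr xs \<le> (M + K) / 4 * average (\<lambda>i. anchor_dist k i \<omega>)"
proof -
  let ?z = "anchor (\<lambda>k. j k \<omega>) (\<lambda>k. x k \<omega>) k"
  have lower: "mat m \<preceq>\<^sub>L H k i \<omega>" and upper: "H k i \<omega> \<preceq>\<^sub>L mat M" and z: "?z i \<in> dom_h"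
    if "i \<in> {1..n}" for i
    using H_lower[OF that assms] H_upper[OF that assms] anchor_in_domain[OF path[OF assms] start]
    by simp_all
  note bounds = proxtone_step[OF K_le_m lower upper z path_minimizes_model[OF path[OF assms]]]
  show "(2 * \<mu> + m) * (norm (xs - x (Suc k) \<omega>))\<^sup>2 \<le> (M + K) * average (\<lambda>i. anchor_dist k i \<omega>)"
    unfolding anchor_dist_def by (rule bounds(1))
  show "fr (x (Suc k) \<omega>) - fr xs \<le> (M + K) / 4 * average (\<lambda>i. anchor_dist k i \<omega>)"
    unfolding anchor_dist_def by (rule bounds(2))
qed

lemma past_determines:
  assumes "\<omega> \<in> space P" and "\<omega>' \<in> space P" and "\<forall>l<k. j l \<omega> = j l \<omega>'"
  shows "anchor_dist k i \<omega> = anchor_dist k i \<omega>'" and "x (Suc k) \<omega> = x (Suc k) \<omega>'"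
proof -
  have "H k i \<omega> = H k i \<omega>'" if "i \<in> {1..n}" "\<forall>l<k. j l \<omega> = j l \<omega>'" for k i
    using H_past that assms(1,2) unfolding determined_by_past_def by blast
  note eq = path_determined_by_past[OF path[OF assms(1)] path[OF assms(2)] m_pos
      H_lower[OF _ assms(1)] this assms(3)]
  show "anchor_dist k i \<omega> = anchor_dist k i \<omega>'"
    using eq(1) by (simp add: anchor_dist_def)
  show "x (Suc k) \<omega> = x (Suc k) \<omega>'"
    by (rule eq(2))
qed

lemma integrable_anchor_dist: "integrable P (anchor_dist k i)"
  by (rule integrable_past[OF sampling, of k]) (rule past_determines(1))

lemma integrable_iterate: "integrable P (\<lambda>\<omega>. \<phi> (x (Suc k) \<omega>))" for \<phi> :: "real ^ 'p \<Rightarrow> real"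
  by (rule integrable_past[OF sampling, of k], rule arg_cong[where f = \<phi>])
    (rule past_determines(2))

text \<open>The draw of iteration \<open>k\<close> is independent of the iterate just computed and of the current anchors.\<close>

lemma expectation_anchor_dist_Suc:
  assumes i: "i \<in> {1..n}"
  shows "expectation (anchor_dist (Suc k) i)
    = 1 / real n * expectation (\<lambda>\<omega>. (norm (xs - x (Suc k) \<omega>))\<^sup>2)
      + (1 - 1 / real n) * expectation (anchor_dist k i)"
proof -
  let ?Y = "\<lambda>\<omega>. of_bool (j k \<omega> = i) :: real"
  let ?D = "\<lambda>\<omega>. (norm (xs - x (Suc k) \<omega>))\<^sup>2"
  have D: "?D \<omega> = ?D \<omega>'"
    if "\<omega> \<in> space P" "\<omega>' \<in> space P" "\<forall>l<k. j l \<omega> = j l \<omega>'" for \<omega> \<omega>'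
    using past_determines(2)[OF that] by simp
  note nextD = uniform_sampling_next_index[OF sampling D]
  note nextB = uniform_sampling_next_index[OF sampling past_determines(1)]
  have "anchor_dist (Suc k) i = (\<lambda>\<omega>. ?Y \<omega> * ?D \<omega> + anchor_dist k i \<omega> - ?Y \<omega> * anchor_dist k i \<omega>)"
    by (auto simp: anchor_dist_def fun_eq_iff)
  then have "expectation (anchor_dist (Suc k) i)
      = expectation (\<lambda>\<omega>. ?Y \<omega> * ?D \<omega>) + expectation (anchor_dist k i)
        - expectation (\<lambda>\<omega>. ?Y \<omega> * anchor_dist k i \<omega>)"
    using nextD(2)[OF _ _ _ i] nextB(2)[OF _ _ _ i] integrable_anchor_dist[of k i] by simp
  also have "\<dots> = 1 / real n * expectation ?D + expectation (anchor_dist k i)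
        - 1 / real n * expectation (anchor_dist k i)"
    using nextD(3)[OF _ _ _ i] nextB(3)[OF _ _ _ i] by simp
  finally show ?thesis by (simp add: left_diff_distrib)
qed

lemma integrable_average_anchor_dist: "integrable P (\<lambda>\<omega>. average (\<lambda>i. anchor_dist k i \<omega>))"
  by (rule integrable_mult_right, rule Bochner_Integration.integrable_sum, rule integrable_anchor_dist)

lemma expectation_average_anchor_dist:
  "expectation (\<lambda>\<omega>. average (\<lambda>i. anchor_dist k i \<omega>)) = average (\<lambda>i. expectation (anchor_dist k i))"
  using integrable_anchor_dist by simp

lemma anchor_dist_contraction:
  "average (\<lambda>i. expectation (anchor_dist k i)) \<le> rate ^ k * (norm (xs - x0))\<^sup>2"
proof (induction k)
  case 0
  have "anchor_dist 0 i \<omega> = (norm (xs - x0))\<^sup>2" if "\<omega> \<in> space P" for i \<omega>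
    using path[OF that] by (simp add: anchor_dist_def proxtone_path_def)
  then have "expectation (anchor_dist 0 i) = expectation (\<lambda>_. (norm (xs - x0))\<^sup>2)" for i
    by (intro Bochner_Integration.integral_cong) auto
  then have "expectation (anchor_dist 0 i) = (norm (xs - x0))\<^sup>2" for i
    by (simp add: prob_space)
  then show ?case using average_const by simp
next
  case (Suc k)
  let ?D = "\<lambda>\<omega>. (norm (xs - x (Suc k) \<omega>))\<^sup>2"
  let ?A = "average (\<lambda>i. expectation (anchor_dist k i))"
  have "?D \<omega> \<le> (M + K) / (2 * \<mu> + m) * average (\<lambda>i. anchor_dist k i \<omega>)" if "\<omega> \<in> space P" for \<omega>
  proof -
    have "0 < 2 * \<mu> + m" using m_pos mu_nonneg by simp
    then have "?D \<omega> \<le> (M + K) * average (\<lambda>i. anchor_dist k i \<omega>) / (2 * \<mu> + m)"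
      using step_bounds(1)[OF that, of k] by (simp only: pos_le_divide_eq mult.commute[of "?D \<omega>"])
    then show ?thesis by (simp add: mult.commute)
  qed
  then have "expectation ?D
      \<le> expectation (\<lambda>\<omega>. (M + K) / (2 * \<mu> + m) * average (\<lambda>i. anchor_dist k i \<omega>))"
    by (rule integral_mono[OF integrable_iterate
          integrable_mult_right[OF integrable_average_anchor_dist]])
  also have "\<dots> = (M + K) / (2 * \<mu> + m) * ?A"
    by (subst integral_mult_right_zero) (simp only: expectation_average_anchor_dist)
  finally have D: "expectation ?D \<le> (M + K) / (2 * \<mu> + m) * ?A" .
  have "average (\<lambda>i. expectation (anchor_dist (Suc k) i))
      = average (\<lambda>i. 1 / real n * expectation ?D + (1 - 1 / real n) * expectation (anchor_dist k i))"
    by (simp only: expectation_anchor_dist_Suc cong: sum.cong)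
  also have "\<dots> = 1 / real n * expectation ?D + (1 - 1 / real n) * ?A"
    by (simp only: average_add average_const average_scale)
  also have "\<dots> \<le> 1 / real n * ((M + K) / (2 * \<mu> + m) * ?A) + (1 - 1 / real n) * ?A"
    using D by (intro add_right_mono mult_left_mono) auto
  also have "\<dots> = rate * ?A"
    by (simp only: rate_def distrib_right mult.assoc)
  also have "\<dots> \<le> rate * (rate ^ k * (norm (xs - x0))\<^sup>2)"
    using Suc rate_ge_half by (intro mult_left_mono) auto
  finally show ?case by (simp only: power_Suc mult.assoc)
qed

text \<open>The iterate \<open>x k\<close> minimizes the model held at time \<open>k - 1\<close>, when only \<open>k - 1\<close> contractions have
  happened.  The missing factor \<open>rate\<close> is at least \<open>1 / 2\<close>, which is what the constant \<open>(M + K) / 4\<close> in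
  the one-step bound leaves room for.\<close>

theorem expected_objective_gap:
  assumes "1 \<le> k"
  shows "expectation (\<lambda>\<omega>. fr (x k \<omega>)) - fr xs \<le> (M + K) / 2 * rate ^ k * (norm (xs - x0))\<^sup>2"
proof -
  obtain l where k: "k = Suc l" using assms by (cases k) auto
  let ?A = "\<lambda>\<omega>. average (\<lambda>i. anchor_dist l i \<omega>)"
  have "fr (x k \<omega>) \<le> (M + K) / 4 * ?A \<omega> + fr xs" if "\<omega> \<in> space P" for \<omega>
    using step_bounds(2)[OF that, of l] unfolding k by linarith
  then have "expectation (\<lambda>\<omega>. fr (x k \<omega>)) \<le> expectation (\<lambda>\<omega>. (M + K) / 4 * ?A \<omega> + fr xs)"
    unfolding k
    by (rule integral_mono[OF integrable_iterate Bochner_Integration.integrable_add[OF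
            integrable_mult_right[OF integrable_average_anchor_dist] integrable_const]])
  also have "\<dots> = (M + K) / 4 * expectation ?A + fr xs"
    by (subst Bochner_Integration.integral_add[OF
          integrable_mult_right[OF integrable_average_anchor_dist] integrable_const],
        subst integral_mult_right_zero) (simp add: prob_space)
  also have "expectation ?A = average (\<lambda>i. expectation (anchor_dist l i))"
    by (rule expectation_average_anchor_dist)
  finally have "expectation (\<lambda>\<omega>. fr (x k \<omega>)) - fr xs
      \<le> (M + K) / 4 * average (\<lambda>i. expectation (anchor_dist l i))"
    by linarith
  also have "\<dots> \<le> (M + K) / 4 * (rate ^ l * (norm (xs - x0))\<^sup>2)"
    using anchor_dist_contraction[of l] m_pos m_le_M K_nonneg by (intro mult_left_mono) auto
  also have "\<dots> = (M + K) / 2 * (1 / 2 * (rate ^ l * (norm (xs - x0))\<^sup>2))"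
    by simp
  also have "\<dots> \<le> (M + K) / 2 * (rate * (rate ^ l * (norm (xs - x0))\<^sup>2))"
    using rate_ge_half m_pos m_le_M K_nonneg by (intro mult_left_mono mult_right_mono) auto
  finally show ?thesis by (simp only: k power_Suc mult.assoc)
qed

end

theorem theorem3p1:
  fixes n :: nat
    and g :: "nat \<Rightarrow> real ^ 'p \<Rightarrow> real" and dg :: "nat \<Rightarrow> real ^ 'p \<Rightarrow> real ^ 'p"
    and h :: "real ^ 'p \<Rightarrow> ereal"
    and L :: "nat \<Rightarrow> real" and m M \<mu>\<^sub>h :: real
    and x\<^sub>0 x\<^sub>s :: "real ^ 'p"
    and P :: "'w measure" and j :: "nat \<Rightarrow> 'w \<Rightarrow> nat"
    and x :: "nat \<Rightarrow> 'w \<Rightarrow> real ^ 'p" and H :: "nat \<Rightarrow> nat \<Rightarrow> 'w \<Rightarrow> real ^ 'p ^ 'p"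
    and k :: nat
  defines "f \<equiv> objective n g h"
    and "Lmax \<equiv> Max (L ` {1..n})"
  assumes n: "2 \<le> n"
    and h_convex: "ereal_convex h"
    and h_lsc: "lower_semicontinuous h"
    and h_dom: "closed (effective_domain h)"
    and h_strong: "strongly_convex \<mu>\<^sub>h h"
    and g_smooth: "\<And>i. i \<in> {1..n} \<Longrightarrow> smooth_convex_around (effective_domain h) (g i) (dg i)"
    and L_pos: "\<And>i. i \<in> {1..n} \<Longrightarrow> 0 < L i"
    and g_lipschitz: "\<And>i. i \<in> {1..n} \<Longrightarrow> (L i)-lipschitz_on (effective_domain h) (dg i)"
    and x\<^sub>s: "is_arg_min f (\<lambda>_. True) x\<^sub>s"
    and x\<^sub>0: "x\<^sub>0 \<in> effective_domain f"
    and sampling: "uniform_sampling P n j"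
    and H_past: "determined_by_past P j H n"
    and iterates: "\<And>\<omega>. \<omega> \<in> space P \<Longrightarrow>
      proxtone_path n g dg h x\<^sub>0 (\<lambda>k. j k \<omega>) (\<lambda>k. x k \<omega>) (\<lambda>k i. H k i \<omega>)"
    and H_bounds: "\<And>i k \<omega>. i \<in> {1..n} \<Longrightarrow> 1 \<le> k \<Longrightarrow> \<omega> \<in> space P \<Longrightarrow>
      mat (L i) \<preceq>\<^sub>L mat m \<and> mat m \<preceq>\<^sub>L H k i \<omega> \<and> H k i \<omega> \<preceq>\<^sub>L mat M"
    and k: "1 \<le> k"
  shows "(\<forall>\<omega>\<in>space P. f (x k \<omega>) < \<infinity>) \<and>
    integrable P (\<lambda>\<omega>. real_of_ereal (f (x k \<omega>))) \<and>
    prob_space.expectation P (\<lambda>\<omega>. real_of_ereal (f (x k \<omega>))) - real_of_ereal (f x\<^sub>s)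
      \<le> (M + Lmax) / 2
        * (1 / real n * ((M + Lmax) / (2 * \<mu>\<^sub>h + m)) + (1 - 1 / real n)) ^ k
        * (norm (x\<^sub>s - x\<^sub>0))\<^sup>2"
proof -
  have one: "1 \<in> {1..n}" using n by simp
  obtain \<omega>1 where \<omega>1: "\<omega>1 \<in> space P"
    using uniform_sampling_index_attained[OF sampling one] by metis
  have L_le: "L i \<le> Lmax" if "i \<in> {1..n}" for i
    unfolding Lmax_def using that by (intro Max_ge) auto
  have "L i \<le> m" if "i \<in> {1..n}" for i
    using loewner_le_mat_bounds[OF _ loewner_le_refl] H_bounds[OF that order_refl \<omega>1] by blast
  then have Lmax_le: "Lmax \<le> m"
    unfolding Lmax_def using one by (subst Max_le_iff) auto
  have Lmax_pos: "0 < Lmax" using L_pos[OF one] L_le[OF one] by linarith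
  have dom_iff: "y \<in> effective_domain f \<longleftrightarrow> y \<in> effective_domain h" for y
    by (cases "h y") (simp_all add: effective_domain_def f_def objective_def)

  \<comment> \<open>a path on which \<open>i\<close> is not drawn first keeps the initial matrix until time 1\<close>
  have H_0: "H 0 i \<omega> = H 1 i \<omega>'"
    if i: "i \<in> {1..n}" and "\<omega> \<in> space P" "\<omega>' \<in> space P" "j 0 \<omega>' \<noteq> i" for i \<omega> \<omega>'
  proof -
    have "H 0 i \<omega> = H 0 i \<omega>'"
      using H_past that unfolding determined_by_past_def by blast
    also have "\<dots> = H 1 i \<omega>'"
      using iterates[OF that(3)] that by (simp add: proxtone_path_def)
    finally show ?thesis .
  qed
  have H_all: "mat m \<preceq>\<^sub>L H k i \<omega> \<and> H k i \<omega> \<preceq>\<^sub>L mat M"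
    if i: "i \<in> {1..n}" and \<omega>: "\<omega> \<in> space P" for k i \<omega>
  proof (cases k)
    case 0
    \<comment> \<open>a different index to draw first, which exists as \<open>2 \<le> n\<close>\<close>
    define i' where "i' = (if i = 1 then 2 else 1 :: nat)"
    have "i' \<in> {1..n}" using n by (simp add: i'_def)
    then obtain \<omega>' where \<omega>': "\<omega>' \<in> space P" "j 0 \<omega>' = i'"
      by (rule uniform_sampling_index_attained[OF sampling])
    then have "j 0 \<omega>' \<noteq> i" by (simp add: i'_def)
    then show ?thesis
      using H_0[OF i \<omega> \<omega>'(1)] H_bounds[OF i order_refl \<omega>'(1)] 0 by simp
  next
    case (Suc l)
    then show ?thesis using H_bounds[OF i _ \<omega>, of k] by simp
  qed

  interpret proxtone n g dg h Lmax \<mu>\<^sub>h x\<^sub>s m M x\<^sub>0 P j x H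
  proof unfold_locales
    show "Lmax-lipschitz_on (effective_domain h) (dg i)" if "i \<in> {1..n}" for i
      using g_lipschitz[OF that] L_le[OF that] by (rule lipschitz_on_le)
    show "is_arg_min (objective n g h) (\<lambda>_. True) x\<^sub>s" using x\<^sub>s by (simp add: f_def)
    show "effective_domain h \<noteq> {}" "x\<^sub>0 \<in> effective_domain h" using x\<^sub>0 dom_iff by auto
  qed (use n Lmax_pos Lmax_le h_strong g_smooth sampling H_past iterates H_all in auto)

  obtain l where l: "k = Suc l" using k by (cases k) auto
  show ?thesis
  proof (intro conjI ballI)
    show "f (x k \<omega>) < \<infinity>" if "\<omega> \<in> space P" for \<omega>
      using iterate_in_domain[OF that, of k] dom_iff by (auto simp: effective_domain_def)
    show "integrable P (\<lambda>\<omega>. real_of_ereal (f (x k \<omega>)))"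
      unfolding l by (rule integrable_iterate)
    show "expectation (\<lambda>\<omega>. real_of_ereal (f (x k \<omega>))) - real_of_ereal (f x\<^sub>s)
      \<le> (M + Lmax) / 2
        * (1 / real n * ((M + Lmax) / (2 * \<mu>\<^sub>h + m)) + (1 - 1 / real n)) ^ k
        * (norm (x\<^sub>s - x\<^sub>0))\<^sup>2"
      using expected_objective_gap[OF k] unfolding rate_def f_def .
  qed
qed

end
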